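(* Let $\lambda(t)=(\lambda_1(t),\dots,\lambda_n(t))$ be the ordered eigenvalue process (Dyson Brownian motion) of the symmetric-matrix Ornstein–Uhlenbeck process with parameters $\alpha,\beta>0$ described in the context, started from a matrix with simple spectrum. The Stratonovich SDE on $\mathrm{O}(n)$ $$\mathrm{d}X(t)=\sqrt{\alpha}\sum_{1\le\ell<k\le n}\left(\frac{X(t)E_{(\ell,k)}}{\lambda_k(t)-\lambda_\ell(t)}\right)\circ\mathrm{d}W^{(\ell,k)}(t)$$ is the same as the following system of Itô SDEs (the eigenvector SDE) for the columns of $X(t)=(v_1(t),\dots,v_n(t))$, viewed as an SDE on $\mathbb{R}^{n\times n}$: $$\mathrm{d}v_k(t)=-\frac{\alpha}{2}\sum_{\ell\ne k}\frac{v_k(t)}{(\lambda_k(t)-\lambda_\ell(t))^2}\,\mathrm{d}t+\sqrt{\alpha}\sum_{\ell\ne k}\frac{v_\ell(t)}{\lambda_k(t)-\lambda_\ell(t)}\,\mathrm{d}w_{\ell k}(t),\qquad 1\le k\le n,$$ where $w_{\ell k}=w_{k\ell}=W^{(\ell,k)}$ for $\ell<k$.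
   Context: $\mathrm{O}(n)=\{X\in\mathbb{R}^{n\times n}:X^TX=\mathrm{Id}\}$. For $1\le\ell<k\le n$, $E_{(\ell,k)}=e_\ell e_k^T-e_ke_\ell^T$ is the skew-symmetric matrix with entry $1$ at $(\ell,k)$, $-1$ at $(k,\ell)$, and $0$ elsewhere. The matrix Ornstein–Uhlenbeck process on real symmetric $n\times n$ matrices is $\mathrm{d}M_{ij}=\mathrm{d}M_{ji}=-\beta M_{ij}\,\mathrm{d}t+\sqrt{(1+\delta_{ij})\alpha}\,\mathrm{d}B_{ij}$, $1\le i\le j\le n$, with independent standard Brownian motions $B_{ij}$, and $M(0)$ has simple spectrum. Its ordered eigenvalues $\lambda_1(t)>\dots>\lambda_n(t)$ satisfy $\mathrm{d}\lambda_k=\big(\alpha\sum_{\ell\ne k}\frac{1}{\lambda_k-\lambda_\ell}-\beta\lambda_k\big)\mathrm{d}t+\sqrt{2\alpha}\,\mathrm{d}W_k$ with independent standard Brownian motions $W_1,\dots,W_n$. The orthonormal eigenvectors $v_1(t),\dots,v_n(t)$ of $M(t)$ associated to these eigenvalues satisfy the eigenvector SDE displayed in the claim; the $W^{(\ell,k)}$, $1\le\ell<k\le n$, are independent standard one-dimensional Brownian motions, independent of the eigenvalue trajectories. Convention: a Stratonovich SDE $\mathrm{d}X(t)=\sum_i V_i(t,X(t))\circ\mathrm{d}W^i(t)$ driven by (time-dependent) vector fields $V_i$ denotes the Itô SDE $\mathrm{d}X(t)=\frac12\sum_i(\nabla_{V_i}V_i)(t,X(t))\,\mathrm{d}t+\sum_iV_i(t,X(t))\,\mathrm{d}W^i(t)$,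 where $(\nabla_UV)(x)=\frac{\mathrm{d}}{\mathrm{d}s}\big|_{s=0}V(x+sU(x))$. In particular, for left-invariant fields $V_i(t,X)=c_i(t)Xz_i$ with $z_i$ skew-symmetric, viewed on $\mathbb{R}^{n\times n}$, this is $\mathrm{d}X=\frac12\sum_ic_i(t)^2Xz_i^2\,\mathrm{d}t+\sum_ic_i(t)Xz_i\,\mathrm{d}W^i$. *)

theory Defs
  imports "HOL-Probability.Probability"
begin

section \<open>Brownian motion and the Ito integral\<close>

text \<open>
  \<open>W i\<close>, \<open>i \<in> I\<close>, are independent standard one-dimensional Brownian motions with respect to the
  filtration \<open>F\<close>.  The whole vector of increments over \<open>[s, t]\<close> is independent of \<open>F s\<close> and its
  components are mutually independent; this implies the independence of the processes \<open>W i\<close>.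
\<close>

definition brownian_family ::
  "'w measure \<Rightarrow> (real \<Rightarrow> 'w measure) \<Rightarrow> 'i set \<Rightarrow> ('i \<Rightarrow> real \<Rightarrow> 'w \<Rightarrow> real) \<Rightarrow> bool" where
  "brownian_family P F I W \<longleftrightarrow>
     (\<forall>i\<in>I. (\<forall>t\<ge>0. W i t \<in> borel_measurable (F t)) \<and>
            (AE \<omega> in P. W i 0 \<omega> = 0 \<and> continuous_on {0..} (\<lambda>t. W i t \<omega>)) \<and>
            (\<forall>s t. 0 \<le> s \<and> s < t \<longrightarrow>
               distributed P lborel (\<lambda>\<omega>. W i t \<omega> - W i s \<omega>) (normal_density 0 (sqrt (t - s))))) \<and>
     (\<forall>s t. 0 \<le> s \<and> s < t \<longrightarrow>
        prob_space.indep_vars P (\<lambda>_. borel) (\<lambda>i \<omega>. W i t \<omega> - W i s \<omega>) I \<and>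
        prob_space.indep_set P (sets (F s))
          (sets (vimage_algebra (space P) (\<lambda>\<omega>. \<lambda>i\<in>I. W i t \<omega> - W i s \<omega>) (PiM I (\<lambda>_. borel)))))"

definition progressively_measurable_upto ::
  "(real \<Rightarrow> 'w measure) \<Rightarrow> real \<Rightarrow> (real \<Rightarrow> 'w \<Rightarrow> real) \<Rightarrow> bool" where
  "progressively_measurable_upto F t H \<longleftrightarrow>
     (\<forall>u\<in>{0..t}. (\<lambda>(s, \<omega>). H s \<omega>) \<in> borel_measurable (restrict_space borel {0..u} \<Otimes>\<^sub>M F u))"

text \<open>
  Simple integrands on \<open>[0, t]\<close>: \<open>\<Sum>j<m. \<xi> j * 1_(p j, p (j+1)]\<close> with \<open>\<xi> j\<close> bounded and
  \<open>F (p j)\<close>-measurable.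
\<close>

definition simple_integrand ::
  "'w measure \<Rightarrow> (real \<Rightarrow> 'w measure) \<Rightarrow> real \<Rightarrow> nat \<Rightarrow> (nat \<Rightarrow> real) \<Rightarrow> (nat \<Rightarrow> 'w \<Rightarrow> real) \<Rightarrow> bool" where
  "simple_integrand P F t m p \<xi> \<longleftrightarrow>
     0 \<le> p 0 \<and> (\<forall>j<m. p j \<le> p (Suc j)) \<and> p m \<le> t \<and>
     (\<forall>j<m. \<xi> j \<in> borel_measurable (F (p j)) \<and> (\<exists>C. \<forall>\<omega>\<in>space P. \<bar>\<xi> j \<omega>\<bar> \<le> C))"

definition simple_value :: "nat \<Rightarrow> (nat \<Rightarrow> real) \<Rightarrow> (nat \<Rightarrow> 'w \<Rightarrow> real) \<Rightarrow> real \<Rightarrow> 'w \<Rightarrow> real" where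
  "simple_value m p \<xi> s \<omega> = (\<Sum>j<m. \<xi> j \<omega> * indicator {p j<..p (Suc j)} s)"

definition simple_ito ::
  "(real \<Rightarrow> 'w \<Rightarrow> real) \<Rightarrow> nat \<Rightarrow> (nat \<Rightarrow> real) \<Rightarrow> (nat \<Rightarrow> 'w \<Rightarrow> real) \<Rightarrow> 'w \<Rightarrow> real" where
  "simple_ito W m p \<xi> \<omega> = (\<Sum>j<m. \<xi> j \<omega> * (W (p (Suc j)) \<omega> - W (p j) \<omega>))"

text \<open>
  The random variable \<open>J\<close> is (a version of) the Ito integral of \<open>H\<close> against \<open>W\<close> over \<open>[0, t]\<close>: some
  sequence of simple integrands converges to \<open>H\<close> in the sense that the integrals of the squared
  differences over \<open>[0, t]\<close> tend to 0 in probability, and their Ito integrals tend to \<open>J\<close> in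
  probability.  For Brownian \<open>W\<close> such a \<open>J\<close> exists iff \<open>H\<close> is almost surely square integrable on
  \<open>[0, t]\<close>, and it is almost surely unique.  The nonnegative integral is used so that a
  nonintegrable square counts as infinite rather than as 0.
\<close>

definition has_ito_integral ::
  "'w measure \<Rightarrow> (real \<Rightarrow> 'w measure) \<Rightarrow> (real \<Rightarrow> 'w \<Rightarrow> real) \<Rightarrow> (real \<Rightarrow> 'w \<Rightarrow> real) \<Rightarrow> real \<Rightarrow>
    ('w \<Rightarrow> real) \<Rightarrow> bool" where
  "has_ito_integral P F W H t J \<longleftrightarrow>
     progressively_measurable_upto F t H \<and> J \<in> borel_measurable P \<and>
     (\<exists>m p \<xi>. (\<forall>n. simple_integrand P F t (m n) (p n) (\<xi> n)) \<and>
        (\<forall>\<epsilon>>0. (\<lambda>n. measure P {\<omega> \<in> space P.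
             (\<integral>\<^sup>+ s\<in>{0..t}. ennreal ((H s \<omega> - simple_value (m n) (p n) (\<xi> n) s \<omega>)\<^sup>2) \<partial>lborel)
               > ennreal \<epsilon>}) \<longlonglongrightarrow> 0) \<and>
        (\<forall>\<epsilon>>0. (\<lambda>n. measure P {\<omega> \<in> space P.
             \<bar>simple_ito W (m n) (p n) (\<xi> n) \<omega> - J \<omega>\<bar> > \<epsilon>}) \<longlonglongrightarrow> 0))"

section \<open>Ito and Stratonovich SDEs\<close>

text \<open>
  \<open>Y\<close> is a continuous adapted process with
  \<open>dY(t) = b(t) dt + (\<Sum>i\<in>I. \<sigma> i (t) dW i (t))\<close>, understood coordinatewise in integrated form.
\<close>

definition has_ito_differential ::
  "'w measure \<Rightarrow> (real \<Rightarrow> 'w measure) \<Rightarrow> 'i set \<Rightarrow> ('i \<Rightarrow> real \<Rightarrow> 'w \<Rightarrow> real) \<Rightarrow>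
    (real \<Rightarrow> 'w \<Rightarrow> 'a) \<Rightarrow> ('i \<Rightarrow> real \<Rightarrow> 'w \<Rightarrow> 'a) \<Rightarrow> (real \<Rightarrow> 'w \<Rightarrow> 'a::euclidean_space) \<Rightarrow> bool" where
  "has_ito_differential P F I W b \<sigma> Y \<longleftrightarrow>
     (\<forall>t\<ge>0. Y t \<in> borel_measurable (F t)) \<and>
     (\<forall>\<omega>\<in>space P. continuous_on {0..} (\<lambda>t. Y t \<omega>)) \<and>
     (\<forall>t\<ge>0. \<forall>e\<in>Basis. \<exists>J.
        (\<forall>i\<in>I. has_ito_integral P F (W i) (\<lambda>s \<omega>. \<sigma> i s \<omega> \<bullet> e) t (J i)) \<and>
        (AE \<omega> in P. set_integrable lborel {0..t} (\<lambda>s. b s \<omega> \<bullet> e) \<and>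
           Y t \<omega> \<bullet> e = Y 0 \<omega> \<bullet> e + (LINT s:{0..t}|lborel. b s \<omega> \<bullet> e) + (\<Sum>i\<in>I. J i \<omega>)))"

definition nabla :: "('a \<Rightarrow> 'a) \<Rightarrow> ('a \<Rightarrow> 'a) \<Rightarrow> 'a \<Rightarrow> 'a::real_normed_vector" where
  "nabla U V x = vector_derivative (\<lambda>s. V (x + s *\<^sub>R U x)) (at 0)"

text \<open>
  The vector fields may depend on time and on \<open>\<omega>\<close>.
\<close>

definition stratonovich_drift ::
  "'i set \<Rightarrow> ('i \<Rightarrow> real \<Rightarrow> 'w \<Rightarrow> 'a \<Rightarrow> 'a) \<Rightarrow> real \<Rightarrow> 'w \<Rightarrow> 'a \<Rightarrow> 'a::real_normed_vector" where
  "stratonovich_drift I V t \<omega> x = (1 / 2) *\<^sub>R (\<Sum>i\<in>I. nabla (V i t \<omega>) (V i t \<omega>) x)"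

text \<open>
  \<open>X\<close> takes values in \<open>S\<close> and solves \<open>dX = (\<Sum>i\<in>I. V i (t, X) \<circ> dW i)\<close>.
\<close>

definition solves_stratonovich_on ::
  "'a set \<Rightarrow> 'w measure \<Rightarrow> (real \<Rightarrow> 'w measure) \<Rightarrow> 'i set \<Rightarrow> ('i \<Rightarrow> real \<Rightarrow> 'w \<Rightarrow> real) \<Rightarrow>
    ('i \<Rightarrow> real \<Rightarrow> 'w \<Rightarrow> 'a \<Rightarrow> 'a) \<Rightarrow> (real \<Rightarrow> 'w \<Rightarrow> 'a::euclidean_space) \<Rightarrow> bool" where
  "solves_stratonovich_on S P F I W V X \<longleftrightarrow>
     (\<forall>t\<ge>0. \<forall>\<omega>\<in>space P. X t \<omega> \<in> S) \<and>
     has_ito_differential P F I W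
       (\<lambda>t \<omega>. stratonovich_drift I V t \<omega> (X t \<omega>)) (\<lambda>i t \<omega>. V i t \<omega> (X t \<omega>)) X"

section \<open>The matrix Ornstein--Uhlenbeck process and its eigenvalues\<close>

text \<open>
  Rows and columns are indexed by a finite linearly ordered type, which plays the role of
  \<open>{1, \<dots>, n}\<close>.
\<close>

type_synonym 'n rvec = "real^'n"
type_synonym 'n sqmat = "real^'n^'n"

definition matrix_OU ::
  "'w measure \<Rightarrow> (real \<Rightarrow> 'w measure) \<Rightarrow> real \<Rightarrow> real \<Rightarrow> ('n::{finite,linorder} \<times> 'n \<Rightarrow> real \<Rightarrow> 'w \<Rightarrow> real) \<Rightarrow>
    (real \<Rightarrow> 'w \<Rightarrow> 'n sqmat) \<Rightarrow> bool" where
  "matrix_OU P F \<alpha> \<beta> B M \<longleftrightarrow>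
     (\<forall>t\<ge>0. \<forall>\<omega>\<in>space P. transpose (M t \<omega>) = M t \<omega>) \<and>
     (\<forall>i j. i \<le> j \<longrightarrow>
        has_ito_differential P F {(i, j)} B (\<lambda>t \<omega>. - \<beta> * M t \<omega> $ i $ j)
          (\<lambda>_ _ _. sqrt ((1 + (if i = j then 1 else 0)) * \<alpha>)) (\<lambda>t \<omega>. M t \<omega> $ i $ j))"

definition simple_spectrum :: "real^'n^'n \<Rightarrow> bool" where
  "simple_spectrum A \<longleftrightarrow> card {x. \<exists>v. v \<noteq> 0 \<and> A *v v = x *\<^sub>R v} = CARD('n)"

text \<open>
  Eigenvalues in decreasing order, counted with multiplicity, so that they are determined for
  every symmetric matrix.  For the matrix Ornstein--Uhlenbeck process started from a matrix with
  simple spectrum they are almost surely pairwise distinct for all times.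
\<close>

definition ordered_eigenvalues :: "'n::{finite,linorder} sqmat \<Rightarrow> 'n rvec \<Rightarrow> bool" where
  "ordered_eigenvalues A l \<longleftrightarrow>
     (\<forall>j k. j \<le> k \<longrightarrow> l $ k \<le> l $ j) \<and> (\<forall>x. det (mat x - A) = (\<Prod>k\<in>UNIV. x - l $ k))"

text \<open>The path of \<open>L\<close> is independent of the joint path of the \<open>W i\<close>, \<open>i \<in> I\<close>.\<close>

definition independent_processes ::
  "'w measure \<Rightarrow> (real \<Rightarrow> 'w \<Rightarrow> 'a::topological_space) \<Rightarrow> 'i set \<Rightarrow> ('i \<Rightarrow> real \<Rightarrow> 'w \<Rightarrow> real) \<Rightarrow> bool" where
  "independent_processes P L I W \<longleftrightarrow>
     prob_space.indep_set P
       (sets (vimage_algebra (space P) (\<lambda>\<omega>. \<lambda>t\<in>{0..}. L t \<omega>) (PiM {0..} (\<lambda>_. borel))))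
       (sets (vimage_algebra (space P) (\<lambda>\<omega>. \<lambda>i\<in>I. \<lambda>t\<in>{0..}. W i t \<omega>)
          (PiM I (\<lambda>_. PiM {0..} (\<lambda>_. borel)))))"

section \<open>The two eigenvector equations\<close>

definition upper_pairs :: "('n::linorder \<times> 'n) set" where
  "upper_pairs = {(l, k). l < k}"

definition skew_unit :: "'n::{finite,linorder} \<times> 'n \<Rightarrow> 'n sqmat" where
  "skew_unit = (\<lambda>(l, k). \<chi> i j. if i = l \<and> j = k then 1 else if i = k \<and> j = l then - 1 else 0)"

definition eigenvector_field ::
  "real \<Rightarrow> (real \<Rightarrow> 'w \<Rightarrow> 'n::{finite,linorder} rvec) \<Rightarrow> 'n \<times> 'n \<Rightarrow> real \<Rightarrow> 'w \<Rightarrow> 'n sqmat \<Rightarrow>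
    'n sqmat" where
  "eigenvector_field \<alpha> L = (\<lambda>(l, k) t \<omega> x.
     sqrt \<alpha> *\<^sub>R ((1 / (L t \<omega> $ k - L t \<omega> $ l)) *\<^sub>R (x ** skew_unit (l, k))))"

text \<open>The fields are tangent to the orthogonal group.\<close>

lemma eigenvector_field_tangent:
  assumes "orthogonal_matrix x" and "l \<noteq> k"
  shows "transpose x ** eigenvector_field \<alpha> L (l, k) t \<omega> x
       + transpose (eigenvector_field \<alpha> L (l, k) t \<omega> x) ** x = 0"
proof -
  have E: "transpose (skew_unit (l, k)) = - skew_unit (l, k)"
    using assms(2) by (auto simp: skew_unit_def transpose_def vec_eq_iff)
  have x: "transpose x ** x = mat 1"
    using assms(1) by (simp add: orthogonal_matrix)
  have T: "transpose (c *\<^sub>R A) = c *\<^sub>R transpose A" for c and A :: "real^'n^'n"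
    by (simp add: transpose_def vec_eq_iff)
  have L: "A ** (c *\<^sub>R B) = c *\<^sub>R (A ** B)" "(c *\<^sub>R A) ** B = c *\<^sub>R (A ** B)"
    for c and A B :: "real^'n^'n"
    by (simp_all add: matrix_matrix_mult_def vec_eq_iff sum_distrib_left algebra_simps)
  show ?thesis
    by (simp add: eigenvector_field_def T L matrix_transpose_mul matrix_mul_assoc x)
       (simp add: E x flip: matrix_mul_assoc)
qed

definition eigenvector_drift ::
  "real \<Rightarrow> (real \<Rightarrow> 'w \<Rightarrow> real^'n) \<Rightarrow> 'n \<Rightarrow> real \<Rightarrow> 'w \<Rightarrow> real^'n^'n \<Rightarrow> real^'n" where
  "eigenvector_drift \<alpha> L k t \<omega> x =
     - (\<alpha> / 2) *\<^sub>R (\<Sum>l\<in>UNIV - {k}. (1 / (L t \<omega> $ k - L t \<omega> $ l)\<^sup>2) *\<^sub>R column k x)"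

definition eigenvector_diffusion ::
  "real \<Rightarrow> (real \<Rightarrow> 'w \<Rightarrow> real^'n) \<Rightarrow> 'n \<Rightarrow> 'n \<Rightarrow> real \<Rightarrow> 'w \<Rightarrow> real^'n^'n \<Rightarrow> real^'n" where
  "eigenvector_diffusion \<alpha> L k l t \<omega> x =
     sqrt \<alpha> *\<^sub>R ((1 / (L t \<omega> $ k - L t \<omega> $ l)) *\<^sub>R column l x)"

definition symmetrize :: "('n \<times> 'n \<Rightarrow> 'c) \<Rightarrow> 'n::linorder \<Rightarrow> 'n \<Rightarrow> 'c" where
  "symmetrize W l k = (if l < k then W (l, k) else W (k, l))"

text \<open>The Ito system for the columns of \<open>X\<close>, driven by \<open>w l k = symmetrize W l k\<close>.\<close>

definition solves_eigenvector_SDE ::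
  "'w measure \<Rightarrow> (real \<Rightarrow> 'w measure) \<Rightarrow> ('n::{finite,linorder} \<times> 'n \<Rightarrow> real \<Rightarrow> 'w \<Rightarrow> real) \<Rightarrow> real \<Rightarrow>
    (real \<Rightarrow> 'w \<Rightarrow> 'n rvec) \<Rightarrow> (real \<Rightarrow> 'w \<Rightarrow> 'n sqmat) \<Rightarrow> bool" where
  "solves_eigenvector_SDE P F W \<alpha> L X \<longleftrightarrow>
     (\<forall>k. has_ito_differential P F (UNIV - {k}) (\<lambda>l. symmetrize W l k)
        (\<lambda>t \<omega>. eigenvector_drift \<alpha> L k t \<omega> (X t \<omega>))
        (\<lambda>l t \<omega>. eigenvector_diffusion \<alpha> L k l t \<omega> (X t \<omega>))
        (\<lambda>t \<omega>. column k (X t \<omega>)))"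

end

theory Submission
  imports Defs
begin

text \<open>
  All fields are linear in the matrix and column \<open>k\<close> of \<open>x E\<close> for the skew unit \<open>E\<close> of a pair is
  zero unless the pair contains \<open>k\<close>, when it is \<open>\<plusminus>\<close> another column.  So the coefficients of the
  two equations agree, the sign being absorbed by the antisymmetry of
  \<open>1 / (\<lambda> k - \<lambda> l)\<close>, and applying a field twice gives the drift.  The two solution
  concepts still differ: the matrix equation also involves Ito integrals of the zero entries of the
  fields, and any random variable \<open>J\<close> with \<open>has_ito_integral\<close> is admitted there.  Such a
  \<open>J\<close> vanishes almost surely, by a truncation argument and the Ito isometry for simple integrands.
\<close>

section \<open>Uniqueness of the Ito integral of zero\<close>

lemma Int_stable_preimages: "Int_stable {f -` A \<inter> S | A. A \<in> sets M}"
proof (rule Int_stableI)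
  fix a b assume "a \<in> {f -` A \<inter> S | A. A \<in> sets M}" "b \<in> {f -` A \<inter> S | A. A \<in> sets M}"
  then obtain A B where "a = f -` A \<inter> S" "A \<in> sets M" "b = f -` B \<inter> S" "B \<in> sets M" by auto
  then have "a \<inter> b = f -` (A \<inter> B) \<inter> S \<and> A \<inter> B \<in> sets M" by auto
  then show "a \<inter> b \<in> {f -` A \<inter> S | A. A \<in> sets M}" by blast
qed

text \<open>One component at a time. Independence of an increment from the past is stated for
  events, so the product sigma-algebra of the whole increment vector appears only where the locale
  is instantiated.\<close>

locale adapted_brownian = prob_space P
  for P :: "'w measure" +
  fixes F :: "real \<Rightarrow> 'w measure" and W :: "real \<Rightarrow> 'w \<Rightarrow> real"
  assumes F_mono: "s \<le> t \<Longrightarrow> sets (F s) \<subseteq> sets (F t)"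
    and F_sub: "subalgebra P (F t)"
    and adapted: "t \<ge> 0 \<Longrightarrow> W t \<in> borel_measurable (F t)"
    and increment_normal: "0 \<le> s \<Longrightarrow> s < t \<Longrightarrow>
          distributed P lborel (\<lambda>\<omega>. W t \<omega> - W s \<omega>) (normal_density 0 (sqrt (t - s)))"
    and increment_indep: "0 \<le> s \<Longrightarrow> s < t \<Longrightarrow> A \<in> sets (F s) \<Longrightarrow> B \<in> sets borel \<Longrightarrow>
          prob (A \<inter> ((\<lambda>\<omega>. W t \<omega> - W s \<omega>) -` B \<inter> space P))
            = prob A * prob ((\<lambda>\<omega>. W t \<omega> - W s \<omega>) -` B \<inter> space P)"

text \<open>A single increment is a coordinate of the increment vector, so its events lie in the
  sigma-algebra generated by that vector and inherit its independence of \<open>F s\<close>.\<close>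

lemma brownian_family_adapted_brownian:
  assumes "prob_space P" and "filtration (space P) F" and "\<And>t. subalgebra P (F t)"
    and W: "brownian_family P F I W" and i: "i \<in> I"
  shows "adapted_brownian P F (W i)"
proof -
  interpret prob_space P by fact
  show ?thesis
  proof
    show "sets (F s) \<subseteq> sets (F t)" if "s \<le> t" for s t
      using filtration.sets_F_mono[OF assms(2) that] by simp
    show "subalgebra P (F t)" for t by fact
    show "W i t \<in> borel_measurable (F t)" if "t \<ge> 0" for t
      using W i that by (auto simp: brownian_family_def)
    fix s t :: real assume st: "0 \<le> s" "s < t"
    show "distributed P lborel (\<lambda>\<omega>. W i t \<omega> - W i s \<omega>) (normal_density 0 (sqrt (t - s)))"
      using W i st by (auto simp: brownian_family_def)
    fix A B :: "_ set" assume A: "A \<in> sets (F s)" and B: "B \<in> sets (borel :: real measure)"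
    let ?D = "\<lambda>\<omega>. \<lambda>i\<in>I. W i t \<omega> - W i s \<omega>"
    let ?V = "vimage_algebra (space P) ?D (PiM I (\<lambda>_. borel))"
    have ind: "indep_set (sets (F s)) (sets ?V)"
      using W st by (auto simp: brownian_family_def)
    have D: "?D \<in> measurable ?V (PiM I (\<lambda>_. borel))"
      by (rule measurable_vimage_algebra1) (auto simp: space_PiM)
    have "(\<lambda>\<omega>. ?D \<omega> i) \<in> measurable ?V borel"
      using measurable_component_singleton[OF i, of "\<lambda>_. borel :: real measure"] D
      by (rule measurable_compose[rotated])
    then have "(\<lambda>\<omega>. W i t \<omega> - W i s \<omega>) \<in> measurable ?V borel"
      using i by simp
    from measurable_sets[OF this B]
    have "(\<lambda>\<omega>. W i t \<omega> - W i s \<omega>) -` B \<inter> space P \<in> sets ?V" by simp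
    from indep_setD[OF ind A this]
    show "prob (A \<inter> ((\<lambda>\<omega>. W i t \<omega> - W i s \<omega>) -` B \<inter> space P))
            = prob A * prob ((\<lambda>\<omega>. W i t \<omega> - W i s \<omega>) -` B \<inter> space P)" .
  qed
qed

context adapted_brownian
begin

lemma measurable_F_mono: "f \<in> borel_measurable (F s) \<Longrightarrow> s \<le> t \<Longrightarrow> f \<in> borel_measurable (F t)"
  using F_mono[of s t] F_sub[of s] F_sub[of t]
  by (auto simp: measurable_def subalgebra_def)

lemma measurable_F_P: "f \<in> borel_measurable (F s) \<Longrightarrow> f \<in> borel_measurable P"
  by (rule measurable_from_subalg[OF F_sub])

lemma W_measurable: "t \<ge> 0 \<Longrightarrow> W t \<in> borel_measurable P"
  by (rule measurable_F_P[OF adapted])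

text \<open>The preimages of Borel sets under each variable form an intersection-stable generator,
  and those under \<open>X\<close> lie in \<open>F s\<close>.\<close>

lemma indep_var_increment:
  fixes X :: "'w \<Rightarrow> real"
  assumes st: "0 \<le> s" "s < t" and X: "X \<in> borel_measurable (F s)"
  shows "indep_var borel X borel (\<lambda>\<omega>. W t \<omega> - W s \<omega>)"
  unfolding indep_var_eq
proof (intro conjI)
  have [measurable]: "W t \<in> borel_measurable P" "W s \<in> borel_measurable P"
    using st by (auto intro: W_measurable)
  show "X \<in> borel_measurable P" by (rule measurable_F_P[OF X])
  then have X'[measurable]: "X \<in> borel_measurable P" .
  show D: "(\<lambda>\<omega>. W t \<omega> - W s \<omega>) \<in> borel_measurable P" by measurable
  show "indep_set (sigma_sets (space P) {X -` A \<inter> space P |A. A \<in> sets borel})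
     (sigma_sets (space P) {(\<lambda>\<omega>. W t \<omega> - W s \<omega>) -` A \<inter> space P |A. A \<in> sets borel})"
  proof (rule indep_set_sigma_sets)
    show "indep_set {X -` A \<inter> space P |A. A \<in> sets borel}
       {(\<lambda>\<omega>. W t \<omega> - W s \<omega>) -` A \<inter> space P |A. A \<in> sets borel}"
    proof (rule indep_setI)
      show "{X -` A \<inter> space P |A. A \<in> sets borel} \<subseteq> events"
        using measurable_sets[OF X'] by auto
      show "{(\<lambda>\<omega>. W t \<omega> - W s \<omega>) -` A \<inter> space P |A. A \<in> sets borel} \<subseteq> events"
        using measurable_sets[OF D] by auto
      fix a b assume "a \<in> {X -` A \<inter> space P |A. A \<in> sets borel}"
        "b \<in> {(\<lambda>\<omega>. W t \<omega> - W s \<omega>) -` A \<inter> space P |A. A \<in> sets borel}"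
      then obtain A B where AB: "a = X -` A \<inter> space P" "A \<in> sets borel"
        "b = (\<lambda>\<omega>. W t \<omega> - W s \<omega>) -` B \<inter> space P" "B \<in> sets borel" by auto
      have "a \<in> sets (F s)"
        using measurable_sets[OF X AB(2)] F_sub[of s] by (simp add: AB subalgebra_def)
      from increment_indep[OF st this AB(4)] show "prob (a \<inter> b) = prob a * prob b"
        by (simp add: AB)
    qed
  qed (rule Int_stable_preimages)+
qed

lemma increment_moments:
  assumes st: "0 \<le> s" "s < t"
  shows "integrable P (\<lambda>\<omega>. W t \<omega> - W s \<omega>)" (is ?i1)
    and "expectation (\<lambda>\<omega>. W t \<omega> - W s \<omega>) = 0" (is ?e1)
    and "integrable P (\<lambda>\<omega>. (W t \<omega> - W s \<omega>)\<^sup>2)" (is ?i2)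
    and "expectation (\<lambda>\<omega>. (W t \<omega> - W s \<omega>)\<^sup>2) = t - s" (is ?e2)
proof -
  note d = increment_normal[OF st]
  have pos: "0 < sqrt (t - s)" using st by simp
  show ?i2
    using distributed_integrable[OF d, of "\<lambda>x. x\<^sup>2"]
      integrable.intros[OF normal_moment_even[OF pos, of 0 1]] by simp
  show ?e1 using normal_distributed_expectation[OF pos d] by simp
  \<comment> \<open>The mean is 0, so the variance is the second moment.\<close>
  then show ?e2 using normal_distributed_variance[OF pos d] pos by simp
  show ?i1
    using distributed_integrable[OF d, of "\<lambda>x. x"]
      integrable.intros[OF normal_moment_nz_1[OF pos, of 0]] by simp
qed

end

section \<open>Energy of simple integrands\<close>

text \<open>Closed form of the time integral of the squared simple integrand; as a finite sum it is
  easily seen to be adapted.\<close>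

definition simple_energy :: "nat \<Rightarrow> (nat \<Rightarrow> real) \<Rightarrow> (nat \<Rightarrow> 'w \<Rightarrow> real) \<Rightarrow> 'w \<Rightarrow> real" where
  "simple_energy m p \<xi> \<omega> = (\<Sum>j<m. (\<xi> j \<omega>)\<^sup>2 * (p (Suc j) - p j))"

lemma simple_integrand_Suc:
  "simple_integrand P F t (Suc m) p \<xi> \<Longrightarrow> simple_integrand P F t m p \<xi>"
  by (fastforce simp: simple_integrand_def less_Suc_eq)

lemma simple_integrand_partition_mono:
  assumes "simple_integrand P F t m p \<xi>" "i \<le> j" "j \<le> m"
  shows "p i \<le> p j"
  using assms(2,3)
proof (induction rule: dec_induct)
  case (step j)
  then have "p i \<le> p j" "p j \<le> p (Suc j)" using assms(1) by (auto simp: simple_integrand_def)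
  then show ?case by simp
qed simp

lemma simple_integrand_partition_nonneg:
  assumes "simple_integrand P F t m p \<xi>" "j \<le> m"
  shows "0 \<le> p j"
  using simple_integrand_partition_mono[OF assms(1) _ assms(2), of 0] assms(1)
  by (auto simp: simple_integrand_def)

lemma simple_value_after:
  assumes "simple_integrand P F t m p \<xi>" "p m < s"
  shows "simple_value m p \<xi> s \<omega> = 0"
  unfolding simple_value_def
proof (rule sum.neutral, rule ballI)
  fix j assume "j \<in> {..<m}"
  then have "p (Suc j) \<le> p m" using simple_integrand_partition_mono[OF assms(1), of "Suc j" m] by auto
  then show "\<xi> j \<omega> * indicator {p j<..p (Suc j)} s = 0" using assms(2) by auto
qed

text \<open>The step intervals are disjoint, so squaring produces no mixed terms; the induction
  splits off the last interval.\<close>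

lemma nn_integral_simple_value_square:
  assumes "simple_integrand P F t m p \<xi>"
  shows "(\<integral>\<^sup>+ s\<in>{0..t}. ennreal ((simple_value m p \<xi> s \<omega>)\<^sup>2) \<partial>lborel)
           = ennreal (simple_energy m p \<xi> \<omega>)"
  using assms
proof (induction m)
  case 0
  show ?case by (simp add: simple_value_def simple_energy_def)
next
  case (Suc m)
  note m = simple_integrand_Suc[OF Suc.prems]
  have p: "p m \<le> p (Suc m)" "0 \<le> p m" "p (Suc m) \<le> t"
    using Suc.prems simple_integrand_partition_nonneg[OF m, of m] by (auto simp: simple_integrand_def)
  have e: "0 \<le> simple_energy m p \<xi> \<omega>"
    using m unfolding simple_energy_def simple_integrand_def
    by (intro sum_nonneg mult_nonneg_nonneg) auto
  have meas[measurable]: "(\<lambda>s. simple_value k p \<xi> s \<omega>) \<in> borel_measurable borel" for k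
    unfolding simple_value_def by measurable
  \<comment> \<open>To the right of \<open>p m\<close> the earlier steps vanish, elsewhere the last
    one does; the last interval lies in \<open>{0..t}\<close>.\<close>
  have split: "ennreal ((simple_value (Suc m) p \<xi> s \<omega>)\<^sup>2) * indicator {0..t} s
      = ennreal ((simple_value m p \<xi> s \<omega>)\<^sup>2) * indicator {0..t} s
        + ennreal ((\<xi> m \<omega>)\<^sup>2) * indicator {p m<..p (Suc m)} s" for s
  proof (cases "p m < s")
    case True
    with simple_value_after[OF m True] p show ?thesis
      by (auto simp: simple_value_def indicator_def)
  next
    case False
    then show ?thesis by (auto simp: simple_value_def indicator_def)
  qed
  have "(\<integral>\<^sup>+ s\<in>{0..t}. ennreal ((simple_value (Suc m) p \<xi> s \<omega>)\<^sup>2) \<partial>lborel)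
      = (\<integral>\<^sup>+ s\<in>{0..t}. ennreal ((simple_value m p \<xi> s \<omega>)\<^sup>2) \<partial>lborel)
        + (\<integral>\<^sup>+ s. ennreal ((\<xi> m \<omega>)\<^sup>2) * indicator {p m<..p (Suc m)} s \<partial>lborel)"
    unfolding split by (rule nn_integral_add) auto
  also have "\<dots> = ennreal (simple_energy (Suc m) p \<xi> \<omega>)"
    unfolding Suc.IH[OF m] using p e
    by (simp add: nn_integral_cmult_indicator simple_energy_def flip: ennreal_mult ennreal_plus)
  finally show ?case .
qed

section \<open>Ito isometry and truncation\<close>

context adapted_brownian
begin

text \<open>Each step value is known at the left end of its interval and the partition is
  deterministic, so the energy including step \<open>j\<close> is already known at
  \<open>p j\<close>. This makes truncation by energy admissible.\<close>

lemma simple_energy_measurable: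
  assumes "simple_integrand P F t m p \<xi>" "j < m"
  shows "simple_energy (Suc j) p \<xi> \<in> borel_measurable (F (p j))"
proof -
  have "\<xi> i \<in> borel_measurable (F (p j))" if "i \<le> j" for i
    using simple_integrand_partition_mono[OF assms(1) that] assms that
    by (intro measurable_F_mono[of "\<xi> i" "p i" "p j"]) (auto simp: simple_integrand_def)
  then show ?thesis
    unfolding simple_energy_def
    by (intro borel_measurable_sum borel_measurable_times borel_measurable_power borel_measurable_const) auto
qed

lemma integrable_bounded_square:
  fixes X :: "'w \<Rightarrow> real"
  assumes [measurable]: "X \<in> borel_measurable P" and C: "\<And>\<omega>. \<omega> \<in> space P \<Longrightarrow> \<bar>X \<omega>\<bar> \<le> C"
  shows "integrable P (\<lambda>\<omega>. (X \<omega>)\<^sup>2)"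
proof (rule integrable_const_bound[of _ "C\<^sup>2"])
  show "AE \<omega> in P. norm ((X \<omega>)\<^sup>2) \<le> C\<^sup>2"
    by (intro AE_I2) (simp add: abs_le_square_iff[symmetric] order_trans[OF C abs_ge_self])
qed measurable

text \<open>Expand the square: \<open>S * X\<close> depends on the past only and is independent of
  the centred increment, so the mixed term has mean 0; in the last term the squares of
  \<open>X\<close> and of the increment factorise.\<close>

lemma second_moment_step:
  assumes st: "0 \<le> s" "s \<le> t"
    and S: "S \<in> borel_measurable (F s)" "integrable P (\<lambda>\<omega>. (S \<omega>)\<^sup>2)"
    and X: "X \<in> borel_measurable (F s)" "\<And>\<omega>. \<omega> \<in> space P \<Longrightarrow> \<bar>X \<omega>\<bar> \<le> C"
  shows "integrable P (\<lambda>\<omega>. (S \<omega> + X \<omega> * (W t \<omega> - W s \<omega>))\<^sup>2)"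
    and "expectation (\<lambda>\<omega>. (S \<omega> + X \<omega> * (W t \<omega> - W s \<omega>))\<^sup>2)
           = expectation (\<lambda>\<omega>. (S \<omega>)\<^sup>2) + expectation (\<lambda>\<omega>. (X \<omega>)\<^sup>2) * (t - s)"
proof -
  let ?D = "\<lambda>\<omega>. W t \<omega> - W s \<omega>"
  have Sm: "S \<in> borel_measurable P" and Xm: "X \<in> borel_measurable P"
    using S X by (auto intro: measurable_F_P)
  have "integrable P (\<lambda>\<omega>. (S \<omega> + X \<omega> * ?D \<omega>)\<^sup>2) \<and>
    expectation (\<lambda>\<omega>. (S \<omega> + X \<omega> * ?D \<omega>)\<^sup>2)
      = expectation (\<lambda>\<omega>. (S \<omega>)\<^sup>2) + expectation (\<lambda>\<omega>. (X \<omega>)\<^sup>2) * (t - s)"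
  \<comment> \<open>Partition points may coincide, whereas the law of an increment is given for
    \<open>s < t\<close>.\<close>
  proof (cases "s = t")
    case True
    then show ?thesis using S by simp
  next
    case False
    with st have st: "0 \<le> s" "s < t" by auto
    note D = increment_moments[OF st]
    have S1: "integrable P S"
      by (rule square_integrable_imp_integrable[OF Sm S(2)])
    \<comment> \<open>Boundedness of \<open>X\<close> gives the majorant
      \<open>C * S\<close>.\<close>
    have SX: "integrable P (\<lambda>\<omega>. S \<omega> * X \<omega>)"
    proof (rule Bochner_Integration.integrable_bound)
      show "integrable P (\<lambda>\<omega>. C * S \<omega>)" using S1 by simp
      show "AE \<omega> in P. norm (S \<omega> * X \<omega>) \<le> norm (C * S \<omega>)"
        using order_trans[OF X(2) abs_ge_self]
        by (intro AE_I2) (simp add: abs_mult mult.commute[of "\<bar>S _\<bar>"] mult_right_mono)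
    qed (use Sm Xm in measurable)
    have X2: "integrable P (\<lambda>\<omega>. (X \<omega>)\<^sup>2)"
      by (rule integrable_bounded_square[OF Xm X(2)])
    have i1: "indep_var borel (\<lambda>\<omega>. S \<omega> * X \<omega>) borel ?D"
      using S X by (intro indep_var_increment[OF st]) measurable
    have "indep_var borel X borel ?D"
      using X by (intro indep_var_increment[OF st])
    from indep_var_compose[OF this, of "\<lambda>x. x\<^sup>2" borel "\<lambda>x. x\<^sup>2" borel]
    have i2: "indep_var borel (\<lambda>\<omega>. (X \<omega>)\<^sup>2) borel (\<lambda>\<omega>. (?D \<omega>)\<^sup>2)"
      by (simp add: comp_def)
    note c1 = indep_var_integrable[OF i1 SX D(1)] and e1 = indep_var_lebesgue_integral[OF i1 SX D(1)]
    note c2 = indep_var_integrable[OF i2 X2 D(3)] and e2 = indep_var_lebesgue_integral[OF i2 X2 D(3)]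
    have *: "(S \<omega> + X \<omega> * ?D \<omega>)\<^sup>2 = (S \<omega>)\<^sup>2 + 2 * (S \<omega> * X \<omega> * ?D \<omega>) + (X \<omega>)\<^sup>2 * (?D \<omega>)\<^sup>2" for \<omega>
      by (simp add: power2_eq_square algebra_simps)
    show ?thesis
      unfolding * using S(2) c1 c2 e1 e2 D by simp
  qed
  then show "integrable P (\<lambda>\<omega>. (S \<omega> + X \<omega> * ?D \<omega>)\<^sup>2)"
    "expectation (\<lambda>\<omega>. (S \<omega> + X \<omega> * ?D \<omega>)\<^sup>2)
      = expectation (\<lambda>\<omega>. (S \<omega>)\<^sup>2) + expectation (\<lambda>\<omega>. (X \<omega>)\<^sup>2) * (t - s)" by auto
qed

text \<open>Induction by \<open>second_moment_step\<close>. The claims are proved together because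
  each step uses measurability of the partial sum at \<open>p m\<close> and integrability of its
  square.\<close>

lemma simple_ito_isometry:
  assumes "simple_integrand P F t m p \<xi>"
  shows "simple_ito W m p \<xi> \<in> borel_measurable (F (p m))" (is ?m)
    and "integrable P (\<lambda>\<omega>. (simple_ito W m p \<xi> \<omega>)\<^sup>2)" (is ?i)
    and "integrable P (simple_energy m p \<xi>)" (is ?j)
    and "expectation (\<lambda>\<omega>. (simple_ito W m p \<xi> \<omega>)\<^sup>2) = expectation (simple_energy m p \<xi>)" (is ?e)
proof -
  have "?m \<and> ?i \<and> ?j \<and> ?e"
    using assms
  proof (induction m)
    case 0
    show ?case by (simp add: simple_ito_def simple_energy_def)
  next
    case (Suc m)
    note IH = Suc.IH[OF simple_integrand_Suc[OF Suc.prems]]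
    have p: "0 \<le> p m" "p m \<le> p (Suc m)"
      using Suc.prems simple_integrand_partition_nonneg[OF Suc.prems, of m]
      by (auto simp: simple_integrand_def)
    obtain C where C: "\<And>\<omega>. \<omega> \<in> space P \<Longrightarrow> \<bar>\<xi> m \<omega>\<bar> \<le> C" and \<xi>: "\<xi> m \<in> borel_measurable (F (p m))"
      using Suc.prems by (force simp: simple_integrand_def)
    have \<xi>P: "\<xi> m \<in> borel_measurable P" by (rule measurable_F_P[OF \<xi>])
    have ito: "simple_ito W (Suc m) p \<xi> = (\<lambda>\<omega>. simple_ito W m p \<xi> \<omega> + \<xi> m \<omega> * (W (p (Suc m)) \<omega> - W (p m) \<omega>))"
      and energy: "simple_energy (Suc m) p \<xi> = (\<lambda>\<omega>. simple_energy m p \<xi> \<omega> + (\<xi> m \<omega>)\<^sup>2 * (p (Suc m) - p m))"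
      by (auto simp: simple_ito_def simple_energy_def)
    have "simple_ito W m p \<xi> \<in> borel_measurable (F (p (Suc m)))" "\<xi> m \<in> borel_measurable (F (p (Suc m)))"
      "W (p m) \<in> borel_measurable (F (p (Suc m)))" "W (p (Suc m)) \<in> borel_measurable (F (p (Suc m)))"
      using IH \<xi> p by (auto intro: measurable_F_mono adapted)
    then have "simple_ito W (Suc m) p \<xi> \<in> borel_measurable (F (p (Suc m)))"
      unfolding ito by measurable
    moreover have "integrable P (\<lambda>\<omega>. (\<xi> m \<omega>)\<^sup>2)"
      by (rule integrable_bounded_square[OF \<xi>P C])
    moreover note second_moment_step[OF p conjunct1[OF IH] conjunct1[OF conjunct2[OF IH]] \<xi> C]
    ultimately show ?case
      using IH unfolding ito energy by simp
  qed
  then show ?m ?i ?j ?e by auto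
qed

text \<open>The integrand is switched off as soon as its accumulated energy exceeds \<open>\<delta>\<close>; the
  second moment of the truncated integral is then at most \<open>\<delta>\<close>.\<close>

lemma simple_ito_tail_bound:
  assumes "simple_integrand P F t m p \<xi>" and "\<epsilon> > 0" and "\<delta> \<ge> 0"
  shows "prob {\<omega> \<in> space P. \<bar>simple_ito W m p \<xi> \<omega>\<bar> > \<epsilon>}
           \<le> prob {\<omega> \<in> space P. simple_energy m p \<xi> \<omega> > \<delta>} + \<delta> / \<epsilon>\<^sup>2"
proof -
  \<comment> \<open>The test includes step \<open>j\<close> itself, hence the index
    \<open>Suc j\<close>: the step that would push the energy past \<open>\<delta>\<close> is
    dropped too.\<close>
  define \<eta> where "\<eta> j \<omega> = (if simple_energy (Suc j) p \<xi> \<omega> \<le> \<delta> then \<xi> j \<omega> else 0)" for j \<omega>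
  have \<eta>: "simple_integrand P F t m p \<eta>"
    unfolding simple_integrand_def
  proof (intro conjI allI impI)
    fix j assume j: "j < m"
    note [measurable] = simple_energy_measurable[OF assms(1) j]
    have [measurable]: "\<xi> j \<in> borel_measurable (F (p j))"
      using assms(1) j by (auto simp: simple_integrand_def)
    show "\<eta> j \<in> borel_measurable (F (p j))"
      unfolding \<eta>_def by measurable
    obtain C where "\<forall>\<omega>\<in>space P. \<bar>\<xi> j \<omega>\<bar> \<le> C"
      using assms(1) j by (auto simp: simple_integrand_def)
    then have "\<forall>\<omega>\<in>space P. \<bar>\<eta> j \<omega>\<bar> \<le> \<bar>C\<bar>" by (fastforce simp: \<eta>_def)
    then show "\<exists>C. \<forall>\<omega>\<in>space P. \<bar>\<eta> j \<omega>\<bar> \<le> C" by blast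
  qed (use assms(1) in \<open>auto simp: simple_integrand_def\<close>)
  have inc: "simple_energy i p \<xi> \<omega> \<le> simple_energy j p \<xi> \<omega>" if "i \<le> j" "j \<le> m" for i j \<omega>
    unfolding simple_energy_def using that assms(1)
    by (intro sum_mono2) (auto simp: simple_integrand_def)
  have energy: "simple_energy m p \<eta> \<omega> \<le> \<delta>" for \<omega>
  proof -
    \<comment> \<open>The comparison with \<open>\<xi>\<close> carries the induction: after a
      retained step the energy of \<open>\<eta>\<close> is at most that of \<open>\<xi>\<close>,
      which passed the test; a dropped step adds nothing.\<close>
    have "k \<le> m \<Longrightarrow> simple_energy k p \<eta> \<omega> \<le> \<delta> \<and> simple_energy k p \<eta> \<omega> \<le> simple_energy k p \<xi> \<omega>" for k
    proof (induction k)
      case 0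
      show ?case using assms(3) by (simp add: simple_energy_def)
    next
      case (Suc k)
      have "0 \<le> (\<xi> k \<omega>)\<^sup>2 * (p (Suc k) - p k)"
        using assms(1) Suc.prems by (auto simp: simple_integrand_def)
      with Suc show ?case
        by (auto simp: simple_energy_def \<eta>_def)
    qed
    then show ?thesis by simp
  qed
  have same: "simple_ito W m p \<eta> \<omega> = simple_ito W m p \<xi> \<omega>" if "simple_energy m p \<xi> \<omega> \<le> \<delta>" for \<omega>
    unfolding simple_ito_def
  proof (rule sum.cong[OF refl])
    fix j assume "j \<in> {..<m}"
    then have "simple_energy (Suc j) p \<xi> \<omega> \<le> \<delta>"
      using inc[of "Suc j" m \<omega>] that by simp
    then show "\<eta> j \<omega> * (W (p (Suc j)) \<omega> - W (p j) \<omega>) = \<xi> j \<omega> * (W (p (Suc j)) \<omega> - W (p j) \<omega>)"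
      by (simp add: \<eta>_def)
  qed
  have [measurable]: "simple_ito W m p \<xi> \<in> borel_measurable P" "simple_ito W m p \<eta> \<in> borel_measurable P"
    "simple_energy m p \<xi> \<in> borel_measurable P"
    using simple_ito_isometry(1)[OF assms(1)] simple_ito_isometry(1)[OF \<eta>] simple_ito_isometry(3)[OF assms(1)]
    by (auto intro: measurable_F_P)
  \<comment> \<open>Off the event of large energy both integrals agree, so a large value there is
    one of the truncated integral.\<close>
  have "prob {\<omega> \<in> space P. \<bar>simple_ito W m p \<xi> \<omega>\<bar> > \<epsilon>}
      \<le> prob ({\<omega> \<in> space P. simple_energy m p \<xi> \<omega> > \<delta>} \<union> {\<omega> \<in> space P. (simple_ito W m p \<eta> \<omega>)\<^sup>2 \<ge> \<epsilon>\<^sup>2})"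
  proof (rule finite_measure_mono)
    show "{\<omega> \<in> space P. \<bar>simple_ito W m p \<xi> \<omega>\<bar> > \<epsilon>}
      \<subseteq> {\<omega> \<in> space P. simple_energy m p \<xi> \<omega> > \<delta>} \<union> {\<omega> \<in> space P. (simple_ito W m p \<eta> \<omega>)\<^sup>2 \<ge> \<epsilon>\<^sup>2}"
    proof
      fix \<omega> assume \<omega>: "\<omega> \<in> {\<omega> \<in> space P. \<bar>simple_ito W m p \<xi> \<omega>\<bar> > \<epsilon>}"
      show "\<omega> \<in> {\<omega> \<in> space P. simple_energy m p \<xi> \<omega> > \<delta>} \<union> {\<omega> \<in> space P. (simple_ito W m p \<eta> \<omega>)\<^sup>2 \<ge> \<epsilon>\<^sup>2}"
        using \<omega> same[of \<omega>] assms(2)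
        by (cases "simple_energy m p \<xi> \<omega> \<le> \<delta>") (auto simp: abs_le_square_iff[symmetric])
    qed
  qed measurable
  also have "\<dots> \<le> prob {\<omega> \<in> space P. simple_energy m p \<xi> \<omega> > \<delta>}
      + prob {\<omega> \<in> space P. (simple_ito W m p \<eta> \<omega>)\<^sup>2 \<ge> \<epsilon>\<^sup>2}"
    by (rule measure_Un_le) measurable
  \<comment> \<open>Markov's inequality for the square; the isometry then turns the second moment
    into expected energy.\<close>
  also have "prob {\<omega> \<in> space P. (simple_ito W m p \<eta> \<omega>)\<^sup>2 \<ge> \<epsilon>\<^sup>2}
      \<le> expectation (\<lambda>\<omega>. (simple_ito W m p \<eta> \<omega>)\<^sup>2) / \<epsilon>\<^sup>2"
    using assms(2) simple_ito_isometry(2)[OF \<eta>]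
    by (intro integral_Markov_inequality_measure[where A="{}"]) auto
  also have "\<dots> \<le> \<delta> / \<epsilon>\<^sup>2"
  proof (rule divide_right_mono)
    have "expectation (simple_energy m p \<eta>) \<le> expectation (\<lambda>_. \<delta>)"
      by (rule integral_mono[OF simple_ito_isometry(3)[OF \<eta>]]) (auto intro: energy)
    then show "expectation (\<lambda>\<omega>. (simple_ito W m p \<eta> \<omega>)\<^sup>2) \<le> \<delta>"
      by (simp add: simple_ito_isometry(4)[OF \<eta>] prob_space)
  qed simp
  finally show ?thesis by simp
qed

text \<open>The energies of the approximating integrands tend to 0 in probability, hence by
  \<open>simple_ito_tail_bound\<close> so do their integrals; limits in probability are almost
  surely unique.\<close>

lemma has_ito_integral_zero_AE:
  assumes "has_ito_integral P F W (\<lambda>_ _. 0) t J"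
  shows "AE \<omega> in P. J \<omega> = 0"
proof -
  obtain m p \<xi> where simple: "\<And>n. simple_integrand P F t (m n) (p n) (\<xi> n)"
    and H: "\<And>\<epsilon>. \<epsilon> > 0 \<Longrightarrow> (\<lambda>n. prob {\<omega> \<in> space P.
             (\<integral>\<^sup>+ s\<in>{0..t}. ennreal ((0 - simple_value (m n) (p n) (\<xi> n) s \<omega>)\<^sup>2) \<partial>lborel)
               > ennreal \<epsilon>}) \<longlonglongrightarrow> 0"
    and I: "\<And>\<epsilon>. \<epsilon> > 0 \<Longrightarrow> (\<lambda>n. prob {\<omega> \<in> space P.
             \<bar>simple_ito W (m n) (p n) (\<xi> n) \<omega> - J \<omega>\<bar> > \<epsilon>}) \<longlonglongrightarrow> 0"
    and [measurable]: "J \<in> borel_measurable P"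
    using assms unfolding has_ito_integral_def by blast
  let ?I = "\<lambda>n. simple_ito W (m n) (p n) (\<xi> n)" and ?E = "\<lambda>n. simple_energy (m n) (p n) (\<xi> n)"
  have [measurable]: "?I n \<in> borel_measurable P" for n
    using simple_ito_isometry(1)[OF simple] by (rule measurable_F_P)
  have E: "(\<lambda>n. prob {\<omega> \<in> space P. ?E n \<omega> > \<delta>}) \<longlonglongrightarrow> 0" if "\<delta> > 0" for \<delta>
    using H[OF that] that
    by (simp add: nn_integral_simple_value_square[OF simple] ennreal_less_iff)
  have small: "AE \<omega> in P. \<bar>J \<omega>\<bar> \<le> 2 * \<epsilon>" if "\<epsilon> > 0" for \<epsilon> :: real
  proof -
    have bound: "prob {\<omega> \<in> space P. \<bar>J \<omega>\<bar> > 2 * \<epsilon>} \<le> \<delta>" if "\<delta> > 0" for \<delta>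
    proof (rule LIMSEQ_le_const)
      \<comment> \<open>The energy threshold \<open>\<delta> * \<epsilon>\<^sup>2\<close> makes the
        remaining term of the tail bound equal to \<open>\<delta>\<close>.\<close>
      let ?u = "\<lambda>n. prob {\<omega> \<in> space P. \<bar>?I n \<omega> - J \<omega>\<bar> > \<epsilon>}
          + (prob {\<omega> \<in> space P. ?E n \<omega> > \<delta> * \<epsilon>\<^sup>2} + \<delta> * \<epsilon>\<^sup>2 / \<epsilon>\<^sup>2)"
      have "?u \<longlonglongrightarrow> 0 + (0 + \<delta> * \<epsilon>\<^sup>2 / \<epsilon>\<^sup>2)"
        using \<open>\<epsilon> > 0\<close> \<open>\<delta> > 0\<close> by (intro tendsto_add I E tendsto_const) auto
      then show "?u \<longlonglongrightarrow> \<delta>" using \<open>\<epsilon> > 0\<close> by simp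
      have "prob {\<omega> \<in> space P. \<bar>J \<omega>\<bar> > 2 * \<epsilon>} \<le> ?u n" for n
      proof -
        have "prob {\<omega> \<in> space P. \<bar>J \<omega>\<bar> > 2 * \<epsilon>}
            \<le> prob ({\<omega> \<in> space P. \<bar>?I n \<omega> - J \<omega>\<bar> > \<epsilon>} \<union> {\<omega> \<in> space P. \<bar>?I n \<omega>\<bar> > \<epsilon>})"
          by (rule finite_measure_mono) auto
        also have "\<dots> \<le> prob {\<omega> \<in> space P. \<bar>?I n \<omega> - J \<omega>\<bar> > \<epsilon>} + prob {\<omega> \<in> space P. \<bar>?I n \<omega>\<bar> > \<epsilon>}"
          by (rule measure_Un_le) measurable
        also have "\<dots> \<le> ?u n"
          using \<open>\<epsilon> > 0\<close> \<open>\<delta> > 0\<close> by (intro add_left_mono simple_ito_tail_bound[OF simple]) auto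
        finally show ?thesis .
      qed
      then show "\<exists>N. \<forall>n\<ge>N. prob {\<omega> \<in> space P. \<bar>J \<omega>\<bar> > 2 * \<epsilon>} \<le> ?u n" by blast
    qed
    have "prob {\<omega> \<in> space P. \<bar>J \<omega>\<bar> > 2 * \<epsilon>} = 0"
      using field_le_epsilon[of "prob {\<omega> \<in> space P. \<bar>J \<omega>\<bar> > 2 * \<epsilon>}" 0] bound
      by (auto intro!: antisym)
    then have "AE \<omega> in P. \<not> (\<bar>J \<omega>\<bar> > 2 * \<epsilon>)"
      by (subst (asm) prob_Collect_eq_0) auto
    then show ?thesis by (simp add: not_less)
  qed
  \<comment> \<open>Countably many thresholds let the quantifier move inside the almost sure
    statement.\<close>
  have "AE \<omega> in P. \<bar>J \<omega>\<bar> \<le> 2 * (1 / real (Suc n))" for n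
    by (rule small) simp
  then have "AE \<omega> in P. \<forall>n. \<bar>J \<omega>\<bar> \<le> 2 * (1 / real (Suc n))"
    unfolding AE_all_countable by blast
  then show ?thesis
  proof eventually_elim
    case (elim \<omega>)
    have "\<bar>J \<omega>\<bar> \<le> 0"
    proof (rule LIMSEQ_le_const)
      show "(\<lambda>n. 2 * (1 / real (Suc n))) \<longlonglongrightarrow> 0"
        by (intro tendsto_mult_right_zero LIMSEQ_Suc lim_inverse_n')
    qed (use elim in blast)
    then show ?case by simp
  qed
qed

end

text \<open>The constant sequence of empty partitions is the approximation. It provides the
  integrals for the pairs that do not affect a given column.\<close>

lemma has_ito_integral_zero: "has_ito_integral P F W (\<lambda>_ _. 0) t (\<lambda>_. 0)"
  if "t \<ge> 0"
proof -
  have "simple_integrand P F t 0 (\<lambda>_. 0) (\<lambda>_ _. 0)"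
    using that by (simp add: simple_integrand_def)
  then show ?thesis
    unfolding has_ito_integral_def progressively_measurable_upto_def
    by (intro conjI exI[of _ "\<lambda>_. 0"] exI[of _ "\<lambda>_ _. 0"] exI[of _ "\<lambda>_ _ _. 0"])
       (auto simp: simple_value_def simple_ito_def)
qed

section \<open>Columns of the eigenvector fields\<close>

text \<open>Symmetrizing \<open>id\<close> returns the index itself, so every symmetrized family is
  the original one composed with this map.\<close>

abbreviation sorted_pair :: "'n::linorder \<Rightarrow> 'n \<Rightarrow> 'n \<times> 'n" where
  "sorted_pair l k \<equiv> symmetrize id l k"

lemma symmetrize_sorted_pair: "symmetrize W l k = W (sorted_pair l k)"
  by (simp add: symmetrize_def)

lemma sorted_pair_upper: "l \<noteq> k \<Longrightarrow> sorted_pair l k \<in> upper_pairs"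
  by (auto simp: symmetrize_def upper_pairs_def)

lemma sorted_pair_image:
  "(\<lambda>l. sorted_pair l k) ` (UNIV - {k}) = {i \<in> upper_pairs. fst i = k \<or> snd i = k}"
  by (auto simp: symmetrize_def upper_pairs_def image_iff split: if_splits)

lemma inj_on_sorted_pair: "inj_on (\<lambda>l. sorted_pair l k) (UNIV - {k})"
  by (auto simp: inj_on_def symmetrize_def split: if_splits)

text \<open>The indices other than \<open>k\<close> correspond bijectively to the pairs containing
  \<open>k\<close>.\<close>

lemma sum_upper_pairs:
  fixes g :: "'n::{finite,linorder} \<times> 'n \<Rightarrow> 'a::comm_monoid_add"
  assumes "\<And>i. i \<in> upper_pairs \<Longrightarrow> fst i \<noteq> k \<Longrightarrow> snd i \<noteq> k \<Longrightarrow> g i = 0"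
  shows "(\<Sum>i\<in>upper_pairs. g i) = (\<Sum>l\<in>UNIV - {k}. g (sorted_pair l k))"
proof -
  have "(\<Sum>i\<in>upper_pairs. g i) = (\<Sum>i\<in>{i \<in> upper_pairs. fst i = k \<or> snd i = k}. g i)"
    using assms by (intro sum.mono_neutral_right) auto
  also have "\<dots> = (\<Sum>l\<in>UNIV - {k}. g (sorted_pair l k))"
    unfolding sorted_pair_image[symmetric] by (subst sum.reindex[OF inj_on_sorted_pair]) simp
  finally show ?thesis .
qed

lemma linear_column: "linear (column k :: real^'n^'m \<Rightarrow> real^'m)"
  by (rule linearI) (simp_all add: column_def vec_eq_iff)

text \<open>Column \<open>k\<close> of the product is \<open>x\<close> applied to column
  \<open>k\<close> of the skew unit, whose only nonzero columns are \<open>m\<close> and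
  \<open>l\<close>: the basis vector \<open>l\<close> and minus the basis vector
  \<open>m\<close>.\<close>

lemma column_mult_skew_unit:
  assumes "l \<noteq> m"
  shows "column k (x ** skew_unit (l, m))
    = (if k = m then column l x else if k = l then - column m x else 0)"
proof -
  have "(x ** skew_unit (l, m)) $ i $ k = (if k = m then x $ i $ l else if k = l then - x $ i $ m else 0)" for i
  proof -
    have "(x ** skew_unit (l, m)) $ i $ k
        = (\<Sum>j\<in>UNIV. if j = l then (if k = m then x $ i $ j else 0) else if j = m \<and> k = l then - x $ i $ j else 0)"
      unfolding matrix_matrix_mult_def skew_unit_def using assms
      by (simp, intro sum.cong) auto
    \<comment> \<open>As \<open>l \<noteq> m\<close>, the nested conditional is a sum of two
      single-index terms.\<close>
    also have "\<dots> = (\<Sum>j\<in>UNIV. (if j = l then (if k = m then x $ i $ j else 0) else 0)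
        + (if j = m then (if k = l then - x $ i $ j else 0) else 0))"
      using assms by (intro sum.cong) auto
    also have "\<dots> = (if k = m then x $ i $ l else if k = l then - x $ i $ m else 0)"
      using assms by (simp add: sum.distrib)
    finally show ?thesis .
  qed
  then show ?thesis
    by (auto simp: column_def vec_eq_iff)
qed

text \<open>For \<open>k < l\<close> the minus sign of the skew unit cancels against the reversed
  eigenvalue difference. For \<open>l = k\<close>, and at coinciding eigenvalues, both sides are 0
  because \<open>1 / 0 = 0\<close>.\<close>

lemma column_eigenvector_field:
  "column k (eigenvector_field \<alpha> L (sorted_pair l k) t \<omega> x) = eigenvector_diffusion \<alpha> L k l t \<omega> x"
proof -
  have swap: "c / (a - b) = - (c / (b - a))" for a b c :: real
    by (metis minus_diff_eq minus_divide_right)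
  show ?thesis
    using swap[of "sqrt \<alpha>" "L t \<omega> $ l" "L t \<omega> $ k"]
    by (cases l k rule: linorder_cases)
       (auto simp: symmetrize_def eigenvector_field_def eigenvector_diffusion_def
          linear_cmul[OF linear_column] column_mult_skew_unit linear_0[OF linear_column] linear_neg[OF linear_column])
qed

lemma column_eigenvector_field_other:
  assumes "i \<in> upper_pairs" "fst i \<noteq> k" "snd i \<noteq> k"
  shows "column k (eigenvector_field \<alpha> L i t \<omega> x) = 0"
  using assms
  by (cases i) (auto simp: upper_pairs_def eigenvector_field_def linear_cmul[OF linear_column]
    column_mult_skew_unit)

lemma linear_eigenvector_field: "linear (eigenvector_field \<alpha> L i t \<omega>)"
  by (cases i, rule linearI)
     (simp_all add: eigenvector_field_def matrix_matrix_mult_def vec_eq_iff sum.distrib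
       sum_distrib_left algebra_simps)

text \<open>A linear map is affine along a line. The Stratonovich correction of a linear field is
  therefore half the field applied twice.\<close>

lemma nabla_linear:
  fixes V :: "'a::euclidean_space \<Rightarrow> 'a"
  assumes "linear V"
  shows "nabla U V x = V (U x)"
proof -
  have "((\<lambda>s. V x + s *\<^sub>R V (U x)) has_vector_derivative V (U x)) (at 0)"
    by (auto intro!: derivative_eq_intros)
  then show ?thesis
    unfolding nabla_def
    by (simp add: linear_add[OF assms] linear_cmul[OF assms] vector_derivative_at)
qed

text \<open>The square of a skew unit is minus the projection onto its two basis directions, so only
  pairs containing \<open>k\<close> contribute, each a multiple of column \<open>k\<close> itself.
  \<open>\<alpha> \<ge> 0\<close> makes the square of \<open>sqrt \<alpha>\<close> equal to
  \<open>\<alpha>\<close>.\<close>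

lemma column_stratonovich_drift:
  assumes "\<alpha> \<ge> 0"
  shows "column k (stratonovich_drift upper_pairs (eigenvector_field \<alpha> L) t \<omega> x)
    = eigenvector_drift \<alpha> L k t \<omega> x"
proof -
  let ?V = "\<lambda>i. eigenvector_field \<alpha> L i t \<omega>"
  have other: "column k (?V i (?V i x)) = 0"
    if "i \<in> upper_pairs" "fst i \<noteq> k" "snd i \<noteq> k" for i
    using column_eigenvector_field_other[OF that] .
  have swap: "sorted_pair l k = sorted_pair k l" for l
    by (auto simp: symmetrize_def)
  have sq: "column k (?V (sorted_pair l k) (?V (sorted_pair l k) x))
      = - \<alpha> *\<^sub>R ((1 / (L t \<omega> $ k - L t \<omega> $ l)\<^sup>2) *\<^sub>R column k x)" for l
  proof -
    \<comment> \<open>The inner application is read from the side of \<open>l\<close>: same pair,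
      opposite eigenvalue difference. The product of the two differences gives the minus
      sign.\<close>
    have "column l (?V (sorted_pair l k) x) = eigenvector_diffusion \<alpha> L l k t \<omega> x"
      unfolding swap by (rule column_eigenvector_field)
    moreover have "(a - b) * (b - a) = - (a - b)\<^sup>2" for a b :: real
      by (simp add: power2_eq_square algebra_simps)
    ultimately show ?thesis
      unfolding column_eigenvector_field using assms
      by (simp add: eigenvector_diffusion_def)
  qed
  have "column k (stratonovich_drift upper_pairs (eigenvector_field \<alpha> L) t \<omega> x)
      = (1 / 2) *\<^sub>R (\<Sum>i\<in>upper_pairs. column k (?V i (?V i x)))"
    by (simp add: stratonovich_drift_def nabla_linear linear_eigenvector_field
      linear_cmul[OF linear_column] linear_sum[OF linear_column])
  also have "\<dots> = (1 / 2) *\<^sub>R (\<Sum>l\<in>UNIV - {k}. column k (?V (sorted_pair l k) (?V (sorted_pair l k) x)))"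
    by (subst sum_upper_pairs[where k = k]) (auto intro: other)
  also have "\<dots> = eigenvector_drift \<alpha> L k t \<omega> x"
    unfolding sq eigenvector_drift_def scaleR_sum_right[symmetric] by simp
  finally show ?thesis .
qed

section \<open>Columnwise comparison of Ito differentials\<close>

text \<open>Matrices are vectors of rows, hence the nesting of \<open>axis\<close>. Coordinatewise
  conditions for a matrix and for its columns can thus be matched one by one.\<close>

lemma column_inner_axis: "column k x \<bullet> axis r 1 = x \<bullet> axis r (axis k (1::real))"
  by (simp add: inner_axis column_def)

lemma Basis_matrix_iff: "(\<forall>e\<in>(Basis :: (real^'n^'m) set). Q e) \<longleftrightarrow> (\<forall>r k. Q (axis r (axis k 1)))"
  by (auto simp: Basis_vec_def)

lemma Basis_rvec_iff: "(\<forall>e\<in>(Basis :: (real^'m) set). Q e) \<longleftrightarrow> (\<forall>r. Q (axis r 1))"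
  by (auto simp: Basis_vec_def)

text \<open>The matrix equation sums over all pairs, the equation for column \<open>k\<close> only over those
  containing \<open>k\<close>; the stochastic integrals for the remaining pairs have integrand 0.\<close>

lemma has_ito_differential_columns:
  fixes X :: "real \<Rightarrow> 'w \<Rightarrow> 'n::{finite,linorder} sqmat"
  assumes W: "\<And>i. i \<in> upper_pairs \<Longrightarrow> adapted_brownian P F (W i)"
    and \<sigma>: "\<And>i k t \<omega>. i \<in> upper_pairs \<Longrightarrow> fst i \<noteq> k \<Longrightarrow> snd i \<noteq> k \<Longrightarrow> column k (\<sigma> i t \<omega>) = 0"
  shows "has_ito_differential P F upper_pairs W b \<sigma> X \<longleftrightarrow>
    (\<forall>k. has_ito_differential P F (UNIV - {k}) (\<lambda>l. symmetrize W l k)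
       (\<lambda>t \<omega>. column k (b t \<omega>)) (\<lambda>l t \<omega>. column k (\<sigma> (sorted_pair l k) t \<omega>))
       (\<lambda>t \<omega>. column k (X t \<omega>)))"
proof -
  define ito where "ito i t r k J \<longleftrightarrow>
    has_ito_integral P F (W i) (\<lambda>s \<omega>. \<sigma> i s \<omega> \<bullet> axis r (axis k 1)) t J" for i t r k J
  define eq where "eq t r k S \<longleftrightarrow>
    (AE \<omega> in P. set_integrable lborel {0..t} (\<lambda>s. b s \<omega> \<bullet> axis r (axis k 1)) \<and>
       X t \<omega> \<bullet> axis r (axis k 1) = X 0 \<omega> \<bullet> axis r (axis k 1)
         + (LINT s:{0..t}|lborel. b s \<omega> \<bullet> axis r (axis k 1)) + S \<omega>)" for t r k and S :: "'w \<Rightarrow> real"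
  \<comment> \<open>The stochastic term matters only up to null sets.\<close>
  have eq_cong: "eq t r k S \<longleftrightarrow> eq t r k S'" if "AE \<omega> in P. S \<omega> = S' \<omega>" for t r k S S'
    unfolding eq_def using that by (intro AE_cong_simp refl iffI; elim AE_mp; auto)
  have coord: "(\<exists>J. (\<forall>i\<in>upper_pairs. ito i t r k (J i)) \<and> eq t r k (\<lambda>\<omega>. \<Sum>i\<in>upper_pairs. J i \<omega>))
      \<longleftrightarrow> (\<exists>J. (\<forall>l\<in>UNIV - {k}. ito (sorted_pair l k) t r k (J l)) \<and> eq t r k (\<lambda>\<omega>. \<Sum>l\<in>UNIV - {k}. J l \<omega>))"
    (is "?A \<longleftrightarrow> ?B") if t: "t \<ge> 0" for t r k
  proof
    assume ?A
    then obtain J where J: "\<And>i. i \<in> upper_pairs \<Longrightarrow> ito i t r k (J i)"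
      and e: "eq t r k (\<lambda>\<omega>. \<Sum>i\<in>upper_pairs. J i \<omega>)" by blast
    \<comment> \<open>The witness \<open>J i\<close> is an arbitrary version, so it is known to
      vanish only almost surely.\<close>
    have "AE \<omega> in P. J i \<omega> = 0" if i: "i \<in> upper_pairs" "fst i \<noteq> k" "snd i \<noteq> k" for i
    proof -
      have "has_ito_integral P F (W i) (\<lambda>_ _. 0) t (J i)"
        using J[OF i(1)] by (simp add: ito_def \<sigma>[OF i] flip: column_inner_axis)
      then show ?thesis by (rule adapted_brownian.has_ito_integral_zero_AE[OF W[OF i(1)]])
    qed
    then have "AE \<omega> in P. \<forall>i\<in>upper_pairs. fst i \<noteq> k \<longrightarrow> snd i \<noteq> k \<longrightarrow> J i \<omega> = 0"
      by (intro AE_finite_allI) auto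
    then have "AE \<omega> in P. (\<Sum>i\<in>upper_pairs. J i \<omega>) = (\<Sum>l\<in>UNIV - {k}. J (sorted_pair l k) \<omega>)"
      by eventually_elim (auto intro: sum_upper_pairs)
    from eq_cong[OF this] e show ?B
      by (intro exI[of _ "\<lambda>l. J (sorted_pair l k)"]) (auto intro!: J sorted_pair_upper)
  next
    assume ?B
    then obtain J where J: "\<And>l. l \<noteq> k \<Longrightarrow> ito (sorted_pair l k) t r k (J l)"
      and e: "eq t r k (\<lambda>\<omega>. \<Sum>l\<in>UNIV - {k}. J l \<omega>)" by blast
    \<comment> \<open>A pair containing \<open>k\<close> gets the integral indexed by its other
      member, every other pair the integral 0.\<close>
    define J' where "J' i = (if snd i = k then J (fst i) else if fst i = k then J (snd i) else (\<lambda>_. 0))" for i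
    have J': "J' (sorted_pair l k) = J l" if "l \<noteq> k" for l
      using that by (auto simp: J'_def symmetrize_def)
    have "ito i t r k (J' i)" if i: "i \<in> upper_pairs" for i
    proof (cases "fst i = k \<or> snd i = k")
      case True
      then obtain l where "l \<noteq> k" "i = sorted_pair l k"
        using i sorted_pair_image[of k] by blast
      then show ?thesis using J J' by simp
    next
      case False
      then have "ito i t r k (\<lambda>_. 0)"
        using has_ito_integral_zero[OF t] by (simp add: ito_def \<sigma>[OF i] flip: column_inner_axis)
      with False show ?thesis by (simp add: J'_def)
    qed
    moreover have "(\<Sum>i\<in>upper_pairs. J' i \<omega>) = (\<Sum>l\<in>UNIV - {k}. J l \<omega>)" for \<omega>
      by (subst sum_upper_pairs[where k = k]) (simp add: J'_def, simp add: J')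
    ultimately show ?A using e by (intro exI[of _ J']) auto
  qed
  have meas: "X t \<in> borel_measurable (F t) \<longleftrightarrow> (\<forall>k. (\<lambda>\<omega>. column k (X t \<omega>)) \<in> borel_measurable (F t))" for t
    unfolding borel_measurable_euclidean_space[where f = "X t"]
      borel_measurable_euclidean_space[where f = "\<lambda>\<omega>. column _ (X t \<omega>)"] Basis_matrix_iff Basis_rvec_iff column_inner_axis by blast
  have cont: "continuous_on {0..} (\<lambda>t. X t \<omega>) \<longleftrightarrow> (\<forall>k. continuous_on {0..} (\<lambda>t. column k (X t \<omega>)))" for \<omega>
    unfolding continuous_on_componentwise[where f = "\<lambda>t. X t \<omega>"]
      continuous_on_componentwise[where f = "\<lambda>t. column _ (X t \<omega>)"]
      Basis_matrix_iff Basis_rvec_iff column_inner_axis by blast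
  show ?thesis
    unfolding has_ito_differential_def Basis_matrix_iff Basis_rvec_iff column_inner_axis
      symmetrize_sorted_pair[of W] ito_def[symmetric] eq_def[symmetric] meas cont
    using coord by blast
qed

text \<open>The coefficients match column by column, so \<open>has_ito_differential_columns\<close>
  applies; the constraint to \<open>S\<close> is carried along unchanged.\<close>

lemma stratonovich_iff_eigenvector_SDE:
  fixes W :: "'n::{finite,linorder} \<times> 'n \<Rightarrow> real \<Rightarrow> 'w \<Rightarrow> real"
  assumes "\<And>i. i \<in> upper_pairs \<Longrightarrow> adapted_brownian P F (W i)" and "\<alpha> \<ge> 0"
  shows "solves_stratonovich_on S P F upper_pairs W (eigenvector_field \<alpha> L) X \<longleftrightarrow>
    (\<forall>t\<ge>0. \<forall>\<omega>\<in>space P. X t \<omega> \<in> S) \<and> solves_eigenvector_SDE P F W \<alpha> L X"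
  unfolding solves_stratonovich_on_def solves_eigenvector_SDE_def
  by (subst has_ito_differential_columns[OF assms(1)])
     (simp_all add: column_eigenvector_field_other column_eigenvector_field
       column_stratonovich_drift[OF assms(2)])

theorem proposition9:
  fixes P :: "'w measure"
    and F :: "real \<Rightarrow> 'w measure"
    and \<alpha> \<beta> :: real
    and B W :: "'n::{finite,linorder} \<times> 'n \<Rightarrow> real \<Rightarrow> 'w \<Rightarrow> real"
    and M :: "real \<Rightarrow> 'w \<Rightarrow> 'n sqmat"
    and L :: "real \<Rightarrow> 'w \<Rightarrow> 'n rvec"
  assumes "prob_space P"
    and "filtration (space P) F" and "\<And>t. subalgebra P (F t)"
    and "\<alpha> > 0" and "\<beta> > 0"
    and "brownian_family P F {(i, j). i \<le> j} B"
    and "matrix_OU P F \<alpha> \<beta> B M"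
    and "AE \<omega> in P. simple_spectrum (M 0 \<omega>)"
    and "\<And>t \<omega>. t \<ge> 0 \<Longrightarrow> \<omega> \<in> space P \<Longrightarrow> ordered_eigenvalues (M t \<omega>) (L t \<omega>)"
    and "brownian_family P F upper_pairs W"
    and "independent_processes P L upper_pairs W"
  shows
    \<comment> \<open>equal drift and diffusion coefficients; equal solutions among all matrix-valued processes;
       equal solutions among all processes with values in the orthogonal group\<close>
    "(\<forall>t\<ge>0. \<forall>\<omega>\<in>space P. \<forall>x k.
        column k (stratonovich_drift upper_pairs (eigenvector_field \<alpha> L) t \<omega> x)
          = eigenvector_drift \<alpha> L k t \<omega> x \<and>
        (\<forall>h :: 'n \<times> 'n \<Rightarrow> real.
           column k (\<Sum>i\<in>upper_pairs. h i *\<^sub>R eigenvector_field \<alpha> L i t \<omega> x)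
             = (\<Sum>l\<in>UNIV - {k}. symmetrize h l k *\<^sub>R eigenvector_diffusion \<alpha> L k l t \<omega> x))) \<and>
     (\<forall>X. solves_stratonovich_on UNIV P F upper_pairs W (eigenvector_field \<alpha> L) X
            \<longleftrightarrow> solves_eigenvector_SDE P F W \<alpha> L X) \<and>
     (\<forall>X. solves_stratonovich_on {x. orthogonal_matrix x} P F upper_pairs W
                (eigenvector_field \<alpha> L) X
            \<longleftrightarrow> (\<forall>t\<ge>0. \<forall>\<omega>\<in>space P. orthogonal_matrix (X t \<omega>)) \<and>
                solves_eigenvector_SDE P F W \<alpha> L X)"
proof -
  have W: "adapted_brownian P F (W i)" if "i \<in> upper_pairs" for i
    using brownian_family_adapted_brownian[OF assms(1-3) assms(10) that] .
  have \<alpha>: "\<alpha> \<ge> 0" using assms(4) by simp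
  \<comment> \<open>The arbitrary weights \<open>h\<close> take the place of the noise
    increments.\<close>
  have diffusion: "column k (\<Sum>i\<in>upper_pairs. h i *\<^sub>R eigenvector_field \<alpha> L i t \<omega> x)
      = (\<Sum>l\<in>UNIV - {k}. symmetrize h l k *\<^sub>R eigenvector_diffusion \<alpha> L k l t \<omega> x)"
    for h :: "'n \<times> 'n \<Rightarrow> real" and t \<omega> x k
    by (simp add: linear_sum[OF linear_column] linear_cmul[OF linear_column] symmetrize_sorted_pair[of h]
      sum_upper_pairs[where k = k] column_eigenvector_field_other column_eigenvector_field)
  show ?thesis
    by (simp add: diffusion column_stratonovich_drift[OF \<alpha>] stratonovich_iff_eigenvector_SDE[OF W \<alpha>])
qed

end
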